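(* Let $\mathcal{X}\subset\mathbb{R}^n$, $\mathcal{Y}\subset\mathbb{R}^m$ be compact and convex, and let $\phi:\mathcal{X}\times\mathcal{Y}\to\mathbb{R}$ be continuous, with $\phi(\cdot,y)$ convex for each $y$ and $\phi(x,\cdot)$ concave for each $x$. Assume that $\phi$ is $(\beta_{11},\beta_{12},\beta_{22},\beta_{21})$-smooth. Let $M=\max\left(\beta_{11}R_{\mathcal{X}}^2,\beta_{22}R_{\mathcal{Y}}^2,\beta_{12}R_{\mathcal{X}}R_{\mathcal{Y}},\beta_{21}R_{\mathcal{X}}R_{\mathcal{Y}}\right)$. Then Saddle Point Mirror Prox (SP-MP, defined in the context) with $a=\frac{1}{R_{\mathcal{X}}^2}$, $b=\frac{1}{R_{\mathcal{Y}}^2}$ and $\eta=\frac{1}{2M}$ satisfies, for every $t\ge 1$, $$\max_{y\in\mathcal{Y}}\phi\left(\frac1t\sum_{s=1}^tu_{s+1},y\right)-\min_{x\in\mathcal{X}}\phi\left(x,\frac1t\sum_{s=1}^tv_{s+1}\right)\le\frac{4M}{t}.$$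
   Context: $\|\cdot\|_{\mathcal{X}}$ and $\|\cdot\|_{\mathcal{Y}}$ are norms on $\mathbb{R}^n$ and $\mathbb{R}^m$; a star denotes the dual norm, $\|g\|^*=\sup_{\|x\|\le1}g^\top x$. Mirror map: for a convex open set $\mathcal{D}$ with $\mathcal{X}\subset\overline{\mathcal{D}}$, $\mathcal{X}\cap\mathcal{D}\neq\emptyset$, a function $\Phi:\mathcal{D}\to\mathbb{R}$ is a mirror map for $\mathcal{X}$ if it is strictly convex and differentiable, $\nabla\Phi(\mathcal{D})$ is the whole space, and $\|\nabla\Phi(x)\|\to+\infty$ as $x\to\partial\mathcal{D}$. $\Phi_{\mathcal{X}}$ (on $\mathcal{D}_{\mathcal{X}}$) is a mirror map for $\mathcal{X}$ that is $1$-strongly convex w.r.t. $\|\cdot\|_{\mathcal{X}}$ on $\mathcal{X}\cap\mathcal{D}_{\mathcal{X}}$, i.e. $\Phi_{\mathcal{X}}(x)-\Phi_{\mathcal{X}}(x')\le\nabla\Phi_{\mathcal{X}}(x)^\top(x-x')-\frac12\|x-x'\|_{\mathcal{X}}^2$, and $R_{\mathcal{X}}^2=\sup_{x\in\mathcal{X}\cap\mathcal{D}_{\mathcal{X}}}\Phi_{\mathcal{X}}(x)-\min_{x\in\mathcal{X}\cap\mathcal{D}_{\mathcal{X}}}\Phi_{\mathcal{X}}(x)$. $\Phi_{\mathcal{Y}},\mathcal{D}_{\mathcal{Y}},R_{\mathcal{Y}}$ are defined similarly for $\mathcal{Y}$ and $\|\cdot\|_{\mathcal{Y}}$. $R_{\mathcal{X}}$,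 $R_{\mathcal{Y}}$ and $M$ are positive, so that $a,b,\eta$ are well defined. Smoothness: $\phi$ is $(\beta_{11},\beta_{12},\beta_{22},\beta_{21})$-smooth if its partial gradients exist and for all $x,x'\in\mathcal{X}$, $y,y'\in\mathcal{Y}$: $\|\nabla_x\phi(x,y)-\nabla_x\phi(x',y)\|_{\mathcal{X}}^*\le\beta_{11}\|x-x'\|_{\mathcal{X}}$, $\|\nabla_x\phi(x,y)-\nabla_x\phi(x,y')\|_{\mathcal{X}}^*\le\beta_{12}\|y-y'\|_{\mathcal{Y}}$, $\|\nabla_y\phi(x,y)-\nabla_y\phi(x,y')\|_{\mathcal{Y}}^*\le\beta_{22}\|y-y'\|_{\mathcal{Y}}$, $\|\nabla_y\phi(x,y)-\nabla_y\phi(x',y)\|_{\mathcal{Y}}^*\le\beta_{21}\|x-x'\|_{\mathcal{X}}$. SP-MP: let $\mathcal{Z}=\mathcal{X}\times\mathcal{Y}$, $\mathcal{D}=\mathcal{D}_{\mathcal{X}}\times\mathcal{D}_{\mathcal{Y}}$, $\Phi(z)=a\Phi_{\mathcal{X}}(x)+b\Phi_{\mathcal{Y}}(y)$ for $z=(x,y)\in\mathcal{D}$, and $D_\Phi(z,z')=\Phi(z)-\Phi(z')-\nabla\Phi(z')^\top(z-z')$. Let $z_1\in\mathrm{argmin}_{z\in\mathcal{Z}\cap\mathcal{D}}\Phi(z)$. For $t\ge 1$, $z_t=(x_t,y_t)$ and $w_t=(u_t,v_t)$ are given by $$w_{t+1}=\mathrm{argmin}_{z\in\mathcal{Z}\cap\mathcal{D}}\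 \eta(\nabla_x\phi(x_t,y_t),-\nabla_y\phi(x_t,y_t))^\top z+D_\Phi(z,z_t),$$ $$z_{t+1}=\mathrm{argmin}_{z\in\mathcal{Z}\cap\mathcal{D}}\ \eta(\nabla_x\phi(u_{t+1},v_{t+1}),-\nabla_y\phi(u_{t+1},v_{t+1}))^\top z+D_\Phi(z,z_t).$$ *)

theory Defs
  imports "HOL-Analysis.Analysis"
begin

text \<open>A space of type \<^typ>\<open>real^'n\<close> carries its Euclidean norm \<^const>\<open>norm\<close>; an arbitrary norm on
  it is a function satisfying the norm axioms.\<close>

definition is_norm :: "('a::real_vector \<Rightarrow> real) \<Rightarrow> bool" where
  "is_norm N \<longleftrightarrow>
     (\<forall>x. 0 \<le> N x) \<and> (\<forall>x. N x = 0 \<longleftrightarrow> x = 0) \<and>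
     (\<forall>c x. N (c *\<^sub>R x) = \<bar>c\<bar> * N x) \<and> (\<forall>x y. N (x + y) \<le> N x + N y)"

definition dual_norm :: "('a::real_inner \<Rightarrow> real) \<Rightarrow> 'a \<Rightarrow> real" where
  "dual_norm N g = (SUP x\<in>{x. N x \<le> 1}. g \<bullet> x)"

text \<open>Maximum and minimum of a function on a possibly infinite set. The value is meaningful only
  if it is attained: otherwise \<^const>\<open>arg_max_on\<close> and \<^const>\<open>arg_min_on\<close> choose an
  unspecified point, and nothing relates the value to the function on the set.\<close>

definition max_on :: "('a \<Rightarrow> real) \<Rightarrow> 'a set \<Rightarrow> real" where
  "max_on f S = f (arg_max_on f S)"

definition min_on :: "('a \<Rightarrow> real) \<Rightarrow> 'a set \<Rightarrow> real" where
  "min_on f S = f (arg_min_on f S)"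

definition grad :: "('a::real_inner \<Rightarrow> real) \<Rightarrow> 'a \<Rightarrow> 'a" where
  "grad f x = (THE g. GDERIV f x :> g)"

definition strictly_convex_on :: "'a::real_vector set \<Rightarrow> ('a \<Rightarrow> real) \<Rightarrow> bool" where
  "strictly_convex_on S f \<longleftrightarrow> convex S \<and>
     (\<forall>x\<in>S. \<forall>y\<in>S. \<forall>u>0. \<forall>v>0. x \<noteq> y \<longrightarrow> u + v = 1 \<longrightarrow>
        f (u *\<^sub>R x + v *\<^sub>R y) < u * f x + v * f y)"

text \<open>A mirror map for \<open>X\<close> on the domain \<open>D\<close>. Values of \<open>Phi\<close> outside the open set \<open>D\<close> play no
  role. In the last clause all norms are equivalent, so the Euclidean one is used.\<close>

definition mirror_map :: "'a::euclidean_space set \<Rightarrow> 'a set \<Rightarrow> ('a \<Rightarrow> real) \<Rightarrow> bool" where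
  "mirror_map X D Phi \<longleftrightarrow>
     convex D \<and> open D \<and> X \<subseteq> closure D \<and> X \<inter> D \<noteq> {} \<and>
     strictly_convex_on D Phi \<and>
     (\<forall>x\<in>D. Phi differentiable (at x)) \<and>
     grad Phi ` D = UNIV \<and>
     (\<forall>p\<in>frontier D. filterlim (\<lambda>x. norm (grad Phi x)) at_top (at p within D))"

definition strongly_convex_wrt ::
    "real \<Rightarrow> ('a::real_inner \<Rightarrow> real) \<Rightarrow> 'a set \<Rightarrow> ('a \<Rightarrow> real) \<Rightarrow> bool" where
  "strongly_convex_wrt \<alpha> N S f \<longleftrightarrow>
     (\<forall>x\<in>S. \<forall>x'\<in>S. f x - f x' \<le> grad f x \<bullet> (x - x') - \<alpha> / 2 * (N (x - x'))\<^sup>2)"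

definition bregman :: "('a::real_inner \<Rightarrow> real) \<Rightarrow> 'a \<Rightarrow> 'a \<Rightarrow> real" where
  "bregman Phi z z' = Phi z - Phi z' - grad Phi z' \<bullet> (z - z')"

text \<open>\<open>gx\<close> and \<open>gy\<close> are the partial gradients of \<open>\<phi>\<close> on \<open>X \<times> Y\<close>. As \<open>\<phi>\<close> is only given on
  \<open>X \<times> Y\<close>, derivatives are taken within \<open>X\<close> and \<open>Y\<close>; this determines \<open>gx\<close> (\<open>gy\<close>) if \<open>X\<close> (\<open>Y\<close>) has
  nonempty interior, and otherwise \<open>gx\<close> (\<open>gy\<close>) is any choice of gradient. A gradient of an
  extension of \<open>\<phi>\<close> to a neighbourhood is a special case.\<close>

definition partial_gradients ::
    "'a::real_inner set \<Rightarrow> 'b::real_inner set \<Rightarrow> ('a \<Rightarrow> 'b \<Rightarrow> real) \<Rightarrow>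
     ('a \<Rightarrow> 'b \<Rightarrow> 'a) \<Rightarrow> ('a \<Rightarrow> 'b \<Rightarrow> 'b) \<Rightarrow> bool" where
  "partial_gradients X Y \<phi> gx gy \<longleftrightarrow>
     (\<forall>x\<in>X. \<forall>y\<in>Y.
        ((\<lambda>x'. \<phi> x' y) has_derivative (\<lambda>h. gx x y \<bullet> h)) (at x within X) \<and>
        ((\<lambda>y'. \<phi> x y') has_derivative (\<lambda>h. gy x y \<bullet> h)) (at y within Y))"

definition smooth_on ::
    "real \<Rightarrow> real \<Rightarrow> real \<Rightarrow> real \<Rightarrow> ('a::real_inner \<Rightarrow> real) \<Rightarrow> ('b::real_inner \<Rightarrow> real) \<Rightarrow>
     'a set \<Rightarrow> 'b set \<Rightarrow> ('a \<Rightarrow> 'b \<Rightarrow> real) \<Rightarrow> ('a \<Rightarrow> 'b \<Rightarrow> 'a) \<Rightarrow> ('a \<Rightarrow> 'b \<Rightarrow> 'b) \<Rightarrow> bool" where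
  "smooth_on \<beta>11 \<beta>12 \<beta>22 \<beta>21 NX NY X Y \<phi> gx gy \<longleftrightarrow>
     partial_gradients X Y \<phi> gx gy \<and>
     (\<forall>x\<in>X. \<forall>x'\<in>X. \<forall>y\<in>Y. \<forall>y'\<in>Y.
        dual_norm NX (gx x y - gx x' y) \<le> \<beta>11 * NX (x - x') \<and>
        dual_norm NX (gx x y - gx x y') \<le> \<beta>12 * NY (y - y') \<and>
        dual_norm NY (gy x y - gy x y') \<le> \<beta>22 * NY (y - y') \<and>
        dual_norm NY (gy x y - gy x' y) \<le> \<beta>21 * NX (x - x'))"

definition joint_map ::
    "real \<Rightarrow> real \<Rightarrow> ('a \<Rightarrow> real) \<Rightarrow> ('b \<Rightarrow> real) \<Rightarrow> 'a \<times> 'b \<Rightarrow> real" where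
  "joint_map a b PhiX PhiY z = a * PhiX (fst z) + b * PhiY (snd z)"

definition saddle_field ::
    "('a \<Rightarrow> 'b \<Rightarrow> 'a) \<Rightarrow> ('a \<Rightarrow> 'b::uminus \<Rightarrow> 'b) \<Rightarrow> 'a \<times> 'b \<Rightarrow> 'a \<times> 'b" where
  "saddle_field gx gy z = (gx (fst z) (snd z), - gy (fst z) (snd z))"

text \<open>\<open>z\<close> and \<open>w\<close> are iterates of Saddle Point Mirror Prox on the set \<open>S\<close> (to be
  \<open>(X \<times> Y) \<inter> (DX \<times> DY)\<close>) with mirror map \<open>Phi\<close>, step size \<open>\<eta>\<close> and vector field \<open>F\<close>. Indexing
  starts at 1 for \<open>z\<close> and at 2 for \<open>w\<close>; earlier values are irrelevant.\<close>

definition sp_mp ::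
    "'a::real_inner set \<Rightarrow> ('a \<Rightarrow> real) \<Rightarrow> real \<Rightarrow> ('a \<Rightarrow> 'a) \<Rightarrow> (nat \<Rightarrow> 'a) \<Rightarrow> (nat \<Rightarrow> 'a) \<Rightarrow> bool" where
  "sp_mp S Phi \<eta> F z w \<longleftrightarrow>
     is_arg_min Phi (\<lambda>p. p \<in> S) (z 1) \<and>
     (\<forall>t\<ge>1.
        is_arg_min (\<lambda>p. \<eta> * (F (z t) \<bullet> p) + bregman Phi p (z t)) (\<lambda>p. p \<in> S) (w (t + 1)) \<and>
        is_arg_min (\<lambda>p. \<eta> * (F (w (t + 1)) \<bullet> p) + bregman Phi p (z t)) (\<lambda>p. p \<in> S) (z (t + 1)))"

end

theory Submission
  imports Defs
begin

text \<open>
  Mirror prox treats the saddle point problem through the vector field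
  \<open>F = (\<nabla>\<^sub>x \<phi>, - \<nabla>\<^sub>y \<phi>)\<close>. Convexity in \<open>x\<close> and concavity in \<open>y\<close> bound \<open>\<phi> u y - \<phi> x v\<close> by
  \<open>F (u, v) \<bullet> ((u, v) - (x, y))\<close> (\<open>saddle_gap_le\<close>), and by Jensen's inequality the gap of the
  averaged iterates is at most the average of these linear terms, the regret.

  The regret of one round is split as
  \<open>F w \<bullet> (w - p) = F w \<bullet> (z' - p) + F z \<bullet> (w - z') + (F w - F z) \<bullet> (w - z')\<close>, where \<open>w\<close> and \<open>z'\<close>
  are obtained from \<open>z\<close> by a mirror step along \<open>F z\<close> and along \<open>F w\<close>. The optimality conditions of
  the two steps (\<open>mirror_step_three_point\<close>) bound the first two terms by Bregman divergences; after
  cancellation what remains is the telescoping difference \<open>D p z - D p z'\<close> minus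
  \<open>D w z + D z' w\<close>. The last term is absorbed by the latter: Lipschitz continuity of \<open>F\<close>, in the
  norm on the product that the weights \<open>1 / RX\<^sup>2\<close> and \<open>1 / RY\<^sup>2\<close> induce, has constant \<open>2 * M\<close>, and
  the divergence dominates half of the squared norm (\<open>weighted_cross_terms_le\<close>). Hence the total
  regret times \<open>\<eta>\<close> is at most \<open>D p (z 1)\<close>, which is at most the oscillation of the joint mirror map,
  and the weights make that \<open>1 + 1\<close>. This gives \<open>2 / (\<eta> * t) = 4 * M / t\<close>.

  The argument so far needs comparison points in \<open>X \<inter> DX\<close> and \<open>Y \<inter> DY\<close>, where the divergence is
  meaningful. The regret is affine in the comparison point and these sets are dense in \<open>X\<close> and
  \<open>Y\<close>, so the bound extends to all of \<open>X \<times> Y\<close>.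
\<close>

section \<open>Norms and their duals\<close>

lemma is_norm_minus:
  assumes "is_norm N"
  shows "N (- x) = N x"
proof -
  have "N ((- 1) *\<^sub>R x) = \<bar>- 1\<bar> * N x"
    using assms unfolding is_norm_def by blast
  then show ?thesis by simp
qed

lemma is_norm_minus_commute:
  assumes "is_norm N"
  shows "N (x - y) = N (y - x)"
  using is_norm_minus[OF assms, of "x - y"] by simp

text \<open>The unspecified value of a supremum over an unbounded set has to be excluded before
  the dual norm can be used; this is one half of the equivalence of norms in finite dimension. By
  expansion in a basis the norm is Lipschitz, so it attains a positive minimum on the sphere.\<close>

lemma is_norm_lower_bound:
  fixes N :: "'a::euclidean_space \<Rightarrow> real"
  assumes "is_norm N"
  obtains c where "c > 0" "\<And>x. c * norm x \<le> N x"
proof -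
  have nn: "0 \<le> N x" and zero: "N x = 0 \<longleftrightarrow> x = 0" and scale: "N (r *\<^sub>R x) = \<bar>r\<bar> * N x"
    and tri: "N (x + y) \<le> N x + N y" for x y r
    using assms by (auto simp: is_norm_def)
  define K where "K = (\<Sum>i\<in>Basis. N (i :: 'a))"
  have sum_le: "N (\<Sum>i\<in>A. f i) \<le> (\<Sum>i\<in>A. N (f i))" if "finite A" for A and f :: "'a \<Rightarrow> 'a"
    using that
  proof (induction A rule: finite_induct)
    case empty
    then show ?case using zero[of 0] by simp
  next
    case (insert i A)
    then show ?case using tri[of "f i" "\<Sum>i\<in>A. f i"] by simp
  qed
  have upper: "N x \<le> K * norm x" for x
  proof -
    have "N x = N (\<Sum>i\<in>Basis. (x \<bullet> i) *\<^sub>R i)" by (simp add: euclidean_representation)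
    also have "\<dots> \<le> (\<Sum>i\<in>Basis. N ((x \<bullet> i) *\<^sub>R i))" by (rule sum_le) simp
    also have "\<dots> \<le> (\<Sum>i\<in>Basis. norm x * N i)"
      unfolding scale by (intro sum_mono mult_right_mono nn Basis_le_norm)
    finally show ?thesis by (simp add: K_def sum_distrib_left mult.commute)
  qed
  have "\<bar>N x - N y\<bar> \<le> K * dist x y" for x y
    using tri[of "x - y" y] tri[of "y - x" x] upper[of "x - y"] upper[of "y - x"]
    by (simp add: dist_norm norm_minus_commute abs_le_iff)
  moreover have "K \<ge> 0" by (simp add: K_def sum_nonneg nn)
  ultimately have "K-lipschitz_on UNIV N"
    by (intro lipschitz_onI) (auto simp: dist_real_def)
  then have "continuous_on (sphere 0 1) N"
    using lipschitz_on_continuous_on continuous_on_subset by blast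
  moreover have "sphere (0::'a) 1 \<noteq> {}" by simp
  ultimately obtain s where s: "s \<in> sphere 0 1" and min: "\<forall>y\<in>sphere 0 1. N s \<le> N y"
    using continuous_attains_inf[OF compact_sphere] by blast
  show ?thesis
  proof
    have "s \<noteq> 0" using s by auto
    then show "N s > 0" using nn[of s] zero[of s] by linarith
    show "N s * norm x \<le> N x" for x
    proof (cases "x = 0")
      case False
      then have "N s \<le> N ((1 / norm x) *\<^sub>R x)" using min by simp
      then show ?thesis using False by (simp add: scale field_simps)
    qed (simp add: nn)
  qed
qed

lemma inner_le_dual_norm:
  fixes N :: "'a::euclidean_space \<Rightarrow> real"
  assumes "is_norm N"
  shows "g \<bullet> x \<le> dual_norm N g * N x"
proof (cases "x = 0")
  case False
  obtain c where c: "c > 0" "\<And>x. c * norm x \<le> N x"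
    using is_norm_lower_bound[OF assms] by blast
  have bdd: "bdd_above ((\<lambda>x. g \<bullet> x) ` {x. N x \<le> 1})"
  proof (rule bdd_aboveI2)
    fix x assume "x \<in> {x. N x \<le> 1}"
    then have "norm x \<le> 1 / c" using c(2)[of x] c(1) by (simp add: field_simps)
    then have "norm g * norm x \<le> norm g * (1 / c)" by (intro mult_left_mono) auto
    then show "g \<bullet> x \<le> norm g * (1 / c)" using norm_cauchy_schwarz[of g x] by linarith
  qed
  have pos: "N x > 0"
    using assms False unfolding is_norm_def by (metis less_le)
  have "N ((1 / N x) *\<^sub>R x) = \<bar>1 / N x\<bar> * N x"
    using assms unfolding is_norm_def by blast
  then have "N ((1 / N x) *\<^sub>R x) = 1" using pos by simp
  then have "g \<bullet> ((1 / N x) *\<^sub>R x) \<le> dual_norm N g"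
    unfolding dual_norm_def by (intro cSUP_upper bdd) simp
  then show ?thesis using pos by (simp add: field_simps)
next
  case True
  moreover have "N 0 = 0" using assms unfolding is_norm_def by blast
  ultimately show ?thesis by simp
qed

lemma inner_le_of_dual_norm_le:
  fixes N :: "'a::euclidean_space \<Rightarrow> real"
  assumes "is_norm N" "dual_norm N g \<le> B"
  shows "g \<bullet> x \<le> B * N x"
proof -
  have "dual_norm N g * N x \<le> B * N x"
    using assms by (intro mult_right_mono) (auto simp: is_norm_def)
  then show ?thesis using inner_le_dual_norm[OF assms(1), of g x] by linarith
qed

section \<open>First-order conditions and gradients\<close>

text \<open>Both first-order conditions needed below, optimality of a constrained minimiser and the
  gradient inequality of a convex function, say that a linear bound on the increments of a
  function along a segment passes to its directional derivative.\<close>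

lemma directional_derivative_le:
  fixes f :: "'a::real_normed_vector \<Rightarrow> real"
  assumes der: "(f has_derivative f') (at x within S)"
    and S: "convex S" "x \<in> S" "y \<in> S"
    and incr: "\<And>\<tau>. 0 < \<tau> \<Longrightarrow> \<tau> < 1 \<Longrightarrow> f (x + \<tau> *\<^sub>R (y - x)) - f x \<le> \<tau> * c"
  shows "f' (y - x) \<le> c"
proof -
  define l where "l = (\<lambda>\<tau>::real. x + \<tau> *\<^sub>R (y - x))"
  have "l ` {0..1} \<subseteq> S"
  proof safe
    fix \<tau> :: real assume "\<tau> \<in> {0..1}"
    then have "(1 - \<tau>) *\<^sub>R x + \<tau> *\<^sub>R y \<in> S" using S by (auto intro: convexD)
    then show "l \<tau> \<in> S" by (simp add: l_def algebra_simps)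
  qed
  then have f: "(f has_derivative f') (at (l 0) within l ` {0..1})"
    using has_derivative_subset[OF der] by (simp add: l_def)
  have "(l has_derivative (\<lambda>h. h *\<^sub>R (y - x))) (at 0 within {0..1})"
    unfolding l_def by (auto intro!: derivative_eq_intros)
  from has_derivative_in_compose[OF this f]
  have "((\<lambda>\<tau>. f (l \<tau>)) has_derivative (\<lambda>h. f' (h *\<^sub>R (y - x)))) (at 0 within {0..1})" .
  moreover have "f' (h *\<^sub>R (y - x)) = f' (y - x) * h" for h
    using linear_cmul[OF has_derivative_linear[OF der]] by simp
  ultimately have "((\<lambda>\<tau>. f (l \<tau>)) has_field_derivative f' (y - x)) (at 0 within {0..1})"
    by (simp add: has_field_derivative_def)
  then have "((\<lambda>\<tau>. (f (l \<tau>) - f x) / \<tau>) \<longlongrightarrow> f' (y - x)) (at 0 within {0..1})"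
    by (simp add: has_field_derivative_iff l_def)
  then have lim: "((\<lambda>\<tau>. (f (l \<tau>) - f x) / \<tau>) \<longlongrightarrow> f' (y - x)) (at_right 0)"
    using at_within_Icc_at_right[of 0 "1::real"] by simp
  have "\<forall>\<^sub>F \<tau> in at_right 0. (f (l \<tau>) - f x) / \<tau> \<le> c"
    using incr unfolding eventually_at_right_field
    by (intro exI[of _ 1]) (auto simp: l_def field_simps)
  then show ?thesis by (rule tendsto_upperbound[OF lim]) simp
qed

lemma convex_on_gradient_inequality:
  fixes f :: "'a::real_inner \<Rightarrow> real"
  assumes "convex_on S f" "(f has_derivative (\<lambda>h. g \<bullet> h)) (at x within S)" "x \<in> S" "y \<in> S"
  shows "g \<bullet> (y - x) \<le> f y - f x"
proof (rule directional_derivative_le[OF assms(2)])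
  show "convex S" using assms(1) by (rule convex_on_imp_convex)
  fix \<tau> :: real assume "0 < \<tau>" "\<tau> < 1"
  then have "f ((1 - \<tau>) *\<^sub>R x + \<tau> *\<^sub>R y) \<le> (1 - \<tau>) * f x + \<tau> * f y"
    using assms by (intro convex_onD) auto
  then show "f (x + \<tau> *\<^sub>R (y - x)) - f x \<le> \<tau> * (f y - f x)"
    by (simp add: algebra_simps)
qed (use assms in auto)

lemma arg_min_first_order:
  fixes f :: "'a::real_inner \<Rightarrow> real"
  assumes "is_arg_min f (\<lambda>p. p \<in> S) p" "GDERIV f p :> d" "convex S" "u \<in> S"
  shows "0 \<le> d \<bullet> (u - p)"
proof -
  have p: "p \<in> S" and min: "\<And>q. q \<in> S \<Longrightarrow> f p \<le> f q"
    using assms(1) by (auto simp: is_arg_min_def not_less)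
  have "((\<lambda>x. - f x) has_derivative (\<lambda>h. - (h \<bullet> d))) (at p within S)"
    using assms(2) by (auto simp: gderiv_def intro: has_derivative_minus has_derivative_at_withinI)
  then have "- ((u - p) \<bullet> d) \<le> 0"
  proof (rule directional_derivative_le)
    fix \<tau> :: real assume "0 < \<tau>" "\<tau> < 1"
    then have "(1 - \<tau>) *\<^sub>R p + \<tau> *\<^sub>R u \<in> S" using assms p by (auto intro: convexD)
    then show "- f (p + \<tau> *\<^sub>R (u - p)) - - f p \<le> \<tau> * 0"
      using min[of "p + \<tau> *\<^sub>R (u - p)"] by (simp add: algebra_simps)
  qed (use assms p in auto)
  then show ?thesis by (simp add: inner_commute)
qed

lemma grad_eq:
  assumes "GDERIV f x :> d"
  shows "grad f x = d"
  unfolding grad_def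
proof (rule the_equality)
  show "GDERIV f x :> d" by (rule assms)
  fix g assume "GDERIV f x :> g"
  then have "(\<lambda>h. h \<bullet> g) = (\<lambda>h. h \<bullet> d)"
    using assms unfolding gderiv_def by (rule has_derivative_unique)
  then show "g = d" by (metis vector_eq_ldot)
qed

text \<open>By the Riesz representation of the derivative, a differentiable function has a gradient.\<close>

lemma GDERIV_grad:
  fixes f :: "'a::euclidean_space \<Rightarrow> real"
  assumes "f differentiable (at x)"
  shows "GDERIV f x :> grad f x"
proof -
  obtain f' where f': "(f has_derivative f') (at x)"
    using assms by (auto simp: differentiable_def)
  have "f' = (\<lambda>h. h \<bullet> adjoint f' 1)"
    using adjoint_works[OF has_derivative_linear[OF f']] by fastforce
  then have "GDERIV f x :> adjoint f' 1" using f' by (simp add: gderiv_def)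
  then show ?thesis using grad_eq by metis
qed

lemma GDERIV_joint_map:
  assumes "GDERIV PhiX (fst z) :> dx" "GDERIV PhiY (snd z) :> dy"
  shows "GDERIV (joint_map a b PhiX PhiY) z :> (a *\<^sub>R dx, b *\<^sub>R dy)"
proof -
  have "((\<lambda>z. PhiX (fst z)) has_derivative (\<lambda>h. fst h \<bullet> dx)) (at z)"
    using has_derivative_compose[OF has_derivative_fst[OF has_derivative_ident]]
      assms(1) by (fastforce simp: gderiv_def)
  moreover have "((\<lambda>z. PhiY (snd z)) has_derivative (\<lambda>h. snd h \<bullet> dy)) (at z)"
    using has_derivative_compose[OF has_derivative_snd[OF has_derivative_ident]]
      assms(2) by (fastforce simp: gderiv_def)
  ultimately show ?thesis
    unfolding gderiv_def joint_map_def inner_prod_def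
    by (auto intro!: derivative_eq_intros)
qed

lemma bregman_joint_map:
  assumes "GDERIV PhiX (fst q) :> grad PhiX (fst q)" "GDERIV PhiY (snd q) :> grad PhiY (snd q)"
  shows "bregman (joint_map a b PhiX PhiY) p q
    = a * bregman PhiX (fst p) (fst q) + b * bregman PhiY (snd p) (snd q)"
  by (simp add: bregman_def grad_eq[OF GDERIV_joint_map[OF assms]] joint_map_def inner_prod_def
      algebra_simps)

lemma strongly_convex_wrt_bregman_ge:
  assumes "strongly_convex_wrt 1 N S f" "p \<in> S" "q \<in> S" "is_norm N"
  shows "(N (p - q))\<^sup>2 / 2 \<le> bregman f p q"
proof -
  have "N (q - p) = N (p - q)"
    using assms(4) by (rule is_norm_minus_commute)
  moreover have "f q - f p \<le> grad f q \<bullet> (q - p) - 1 / 2 * (N (q - p))\<^sup>2"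
    using assms unfolding strongly_convex_wrt_def by blast
  ultimately show ?thesis by (simp add: bregman_def inner_diff_right)
qed

section \<open>Regret of mirror prox\<close>

text \<open>The optimality condition of the step, in which the gradient of the divergence is
  \<open>grad Phi p - grad Phi z\<close>, together with the identity
  \<open>(grad Phi p - grad Phi z) \<bullet> (u - p) = D u z - D u p - D p z\<close>.\<close>

lemma mirror_step_three_point:
  fixes Phi :: "'a::real_inner \<Rightarrow> real"
  assumes "is_arg_min (\<lambda>p. \<eta> * (g \<bullet> p) + bregman Phi p z) (\<lambda>p. p \<in> S) p"
    and "GDERIV Phi p :> grad Phi p" and "convex S" and "u \<in> S"
  shows "\<eta> * (g \<bullet> (p - u)) \<le> bregman Phi u z - bregman Phi u p - bregman Phi p z"
proof -
  have "GDERIV (\<lambda>p. \<eta> * (g \<bullet> p) + bregman Phi p z) p :> \<eta> *\<^sub>R g + (grad Phi p - grad Phi z)"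
    using assms(2) unfolding gderiv_def bregman_def
    by (auto intro!: derivative_eq_intros simp: inner_simps inner_commute)
  from arg_min_first_order[OF assms(1) this assms(3,4)]
  show ?thesis by (simp add: bregman_def inner_simps algebra_simps)
qed

text \<open>The hypothesis \<open>absorb\<close> is Lipschitz continuity of the field measured directly by the
  divergence: with constant \<open>1 / \<eta>\<close> with respect to a norm for which \<open>Phi\<close> is 1-strongly convex, it
  follows from Young's inequality. The divergence \<open>bregman Phi p (z (t + 1))\<close>
  that telescoping leaves on the right is nonnegative by \<open>breg_nonneg\<close>.\<close>

lemma mirror_prox_regret:
  fixes Phi :: "'a::real_inner \<Rightarrow> real"
  assumes mp: "sp_mp S Phi \<eta> F z w"
    and S: "convex S" and der: "\<And>q. q \<in> S \<Longrightarrow> GDERIV Phi q :> grad Phi q"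
    and breg_nonneg: "\<And>p q. p \<in> S \<Longrightarrow> q \<in> S \<Longrightarrow> 0 \<le> bregman Phi p q"
    and absorb: "\<And>p q r. p \<in> S \<Longrightarrow> q \<in> S \<Longrightarrow> r \<in> S \<Longrightarrow>
      \<eta> * ((F q - F p) \<bullet> (q - r)) \<le> bregman Phi q p + bregman Phi r q"
    and p: "p \<in> S"
  shows "(\<Sum>s=1..t. \<eta> * (F (w (s + 1)) \<bullet> (w (s + 1) - p))) \<le> Phi p - Phi (z 1)"
proof -
  have z1: "is_arg_min Phi (\<lambda>p. p \<in> S) (z 1)"
    and w: "\<And>s. s \<ge> 1 \<Longrightarrow>
      is_arg_min (\<lambda>p. \<eta> * (F (z s) \<bullet> p) + bregman Phi p (z s)) (\<lambda>p. p \<in> S) (w (s + 1))"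
    and z: "\<And>s. s \<ge> 1 \<Longrightarrow>
      is_arg_min (\<lambda>p. \<eta> * (F (w (s + 1)) \<bullet> p) + bregman Phi p (z s)) (\<lambda>p. p \<in> S) (z (s + 1))"
    using mp by (auto simp: sp_mp_def)
  have wS: "w (s + 1) \<in> S" and zS': "z (s + 1) \<in> S" if "s \<ge> 1" for s
    using w[OF that] z[OF that] by (auto simp: is_arg_min_def)
  have zS: "z s \<in> S" if "s \<ge> 1" for s
  proof (cases "s = 1")
    case True
    then show ?thesis using z1 by (simp add: is_arg_min_def)
  next
    case False
    then show ?thesis using zS'[of "s - 1"] that by simp
  qed
  have step: "\<eta> * (F (w (s + 1)) \<bullet> (w (s + 1) - p))
      \<le> bregman Phi p (z s) - bregman Phi p (z (s + 1))" if s: "s \<ge> 1" for s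
  proof -
    have "\<eta> * (F (w (s + 1)) \<bullet> (z (s + 1) - p))
        \<le> bregman Phi p (z s) - bregman Phi p (z (s + 1)) - bregman Phi (z (s + 1)) (z s)"
      using mirror_step_three_point[OF z[OF s] der[OF zS'[OF s]] S p] .
    moreover have "\<eta> * (F (z s) \<bullet> (w (s + 1) - z (s + 1)))
        \<le> bregman Phi (z (s + 1)) (z s) - bregman Phi (z (s + 1)) (w (s + 1))
          - bregman Phi (w (s + 1)) (z s)"
      using mirror_step_three_point[OF w[OF s] der[OF wS[OF s]] S zS'[OF s]] .
    moreover have "\<eta> * ((F (w (s + 1)) - F (z s)) \<bullet> (w (s + 1) - z (s + 1)))
        \<le> bregman Phi (w (s + 1)) (z s) + bregman Phi (z (s + 1)) (w (s + 1))"
      using absorb[OF zS[OF s] wS[OF s] zS'[OF s]] .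
    moreover have "\<eta> * (F (w (s + 1)) \<bullet> (w (s + 1) - p))
        = \<eta> * (F (w (s + 1)) \<bullet> (z (s + 1) - p)) + \<eta> * (F (z s) \<bullet> (w (s + 1) - z (s + 1)))
          + \<eta> * ((F (w (s + 1)) - F (z s)) \<bullet> (w (s + 1) - z (s + 1)))"
      by (simp add: inner_simps algebra_simps)
    ultimately show ?thesis by linarith
  qed
  have "(\<Sum>s=1..t. \<eta> * (F (w (s + 1)) \<bullet> (w (s + 1) - p)))
      \<le> bregman Phi p (z 1) - bregman Phi p (z (t + 1))"
  proof (induction t)
    case (Suc t)
    then show ?case using step[of "Suc t"] by simp
  qed simp
  also have "\<dots> \<le> bregman Phi p (z 1)"
    using breg_nonneg[OF p zS[of "t + 1"]] by simp
  also have "\<dots> \<le> Phi p - Phi (z 1)"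
    using arg_min_first_order[OF z1 der[OF zS[of 1]] S p] by (simp add: bregman_def)
  finally show ?thesis .
qed

section \<open>The saddle field\<close>

text \<open>Here \<open>p\<close>, \<open>q\<close> stand for the lengths of the \<open>x\<close> and \<open>y\<close> components of one displacement, and
  \<open>p'\<close>, \<open>q'\<close> for those of another. In the rescaled lengths \<open>p / RX\<close>, \<open>q / RY\<close> all four smoothness
  constants become at most \<open>M\<close>, and then
  \<open>(x + y) * (x' + y') \<le> x\<^sup>2 + y\<^sup>2 + x'\<^sup>2 + y'\<^sup>2\<close> finishes the estimate.\<close>

lemma weighted_cross_terms_le:
  fixes p q p' q' RX RY M :: real
  assumes "0 \<le> p" "0 \<le> q" "0 \<le> p'" "0 \<le> q'" and R: "0 < RX" "0 < RY" and "0 < M"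
    and "\<beta>11 * RX\<^sup>2 \<le> M" "\<beta>22 * RY\<^sup>2 \<le> M" "\<beta>12 * RX * RY \<le> M" "\<beta>21 * RX * RY \<le> M"
  shows "1 / (2 * M) * ((\<beta>11 * p + \<beta>12 * q) * p' + (\<beta>21 * p + \<beta>22 * q) * q')
    \<le> (1 / RX\<^sup>2) * (p\<^sup>2 / 2) + (1 / RY\<^sup>2) * (q\<^sup>2 / 2)
      + ((1 / RX\<^sup>2) * (p'\<^sup>2 / 2) + (1 / RY\<^sup>2) * (q'\<^sup>2 / 2))"
proof -
  define x y x' y' where "x = p / RX" and "y = q / RY" and "x' = p' / RX" and "y' = q' / RY"
  have nn: "0 \<le> x" "0 \<le> y" "0 \<le> x'" "0 \<le> y'"
    using assms by (auto simp: x_def y_def x'_def y'_def)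
  have eqs: "p = RX * x" "q = RY * y" "p' = RX * x'" "q' = RY * y'"
    using R by (auto simp: x_def y_def x'_def y'_def)
  have "(\<beta>11 * p + \<beta>12 * q) * p' + (\<beta>21 * p + \<beta>22 * q) * q'
      = (\<beta>11 * RX\<^sup>2) * (x * x') + (\<beta>12 * RX * RY) * (y * x')
        + (\<beta>21 * RX * RY) * (x * y') + (\<beta>22 * RY\<^sup>2) * (y * y')"
    unfolding eqs by (simp add: algebra_simps power2_eq_square)
  also have "\<dots> \<le> M * (x * x') + M * (y * x') + M * (x * y') + M * (y * y')"
    using assms nn by (intro add_mono mult_right_mono mult_nonneg_nonneg) auto
  also have "\<dots> = M * ((x + y) * (x' + y'))" by (simp add: algebra_simps)
  also have "\<dots> \<le> M * (x\<^sup>2 + y\<^sup>2 + x'\<^sup>2 + y'\<^sup>2)"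
  proof (rule mult_left_mono)
    show "(x + y) * (x' + y') \<le> x\<^sup>2 + y\<^sup>2 + x'\<^sup>2 + y'\<^sup>2"
      using sum_squares_bound[of x x'] sum_squares_bound[of x y']
        sum_squares_bound[of y x'] sum_squares_bound[of y y'] by (simp add: algebra_simps)
  qed (use \<open>0 < M\<close> in simp)
  finally have "1 / (2 * M) * ((\<beta>11 * p + \<beta>12 * q) * p' + (\<beta>21 * p + \<beta>22 * q) * q')
      \<le> 1 / (2 * M) * (M * (x\<^sup>2 + y\<^sup>2 + x'\<^sup>2 + y'\<^sup>2))"
    using \<open>0 < M\<close> by (intro mult_left_mono) auto
  also have "\<dots> = (x\<^sup>2 + y\<^sup>2 + x'\<^sup>2 + y'\<^sup>2) / 2" using \<open>0 < M\<close> by simp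
  also have "\<dots> = (1 / RX\<^sup>2) * (p\<^sup>2 / 2) + (1 / RY\<^sup>2) * (q\<^sup>2 / 2)
      + ((1 / RX\<^sup>2) * (p'\<^sup>2 / 2) + (1 / RY\<^sup>2) * (q'\<^sup>2 / 2))"
    by (simp add: x_def y_def x'_def y'_def power_divide add_divide_distrib)
  finally show ?thesis .
qed

lemma saddle_field_increment_le:
  fixes X :: "'a::euclidean_space set" and Y :: "'b::euclidean_space set"
  assumes N: "is_norm NX" "is_norm NY"
    and sm: "smooth_on \<beta>11 \<beta>12 \<beta>22 \<beta>21 NX NY X Y \<phi> gx gy"
    and pq: "p \<in> X \<times> Y" "q \<in> X \<times> Y"
  shows "(saddle_field gx gy q - saddle_field gx gy p) \<bullet> d
    \<le> (\<beta>11 * NX (fst (q - p)) + \<beta>12 * NY (snd (q - p))) * NX (fst d)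
      + (\<beta>21 * NX (fst (q - p)) + \<beta>22 * NY (snd (q - p))) * NY (snd d)"
proof -
  obtain x y u v where eqs: "p = (x, y)" "q = (u, v)"
    and mem: "x \<in> X" "y \<in> Y" "u \<in> X" "v \<in> Y" using pq by auto
  have neg: "NY (- e) = NY e" for e
    using N(2) by (rule is_norm_minus)
  have D: "dual_norm NX (gx u v - gx x v) \<le> \<beta>11 * NX (u - x)"
    "dual_norm NX (gx x v - gx x y) \<le> \<beta>12 * NY (v - y)"
    "dual_norm NY (gy x v - gy x y) \<le> \<beta>22 * NY (v - y)"
    "dual_norm NY (gy u v - gy x v) \<le> \<beta>21 * NX (u - x)"
    using sm mem unfolding smooth_on_def by blast+
  have "(gx u v - gx x v) \<bullet> fst d \<le> \<beta>11 * NX (u - x) * NX (fst d)"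
    "(gx x v - gx x y) \<bullet> fst d \<le> \<beta>12 * NY (v - y) * NX (fst d)"
    "(gy x v - gy x y) \<bullet> (- snd d) \<le> \<beta>22 * NY (v - y) * NY (- snd d)"
    "(gy u v - gy x v) \<bullet> (- snd d) \<le> \<beta>21 * NX (u - x) * NY (- snd d)"
    by (intro inner_le_of_dual_norm_le N D)+
  then show ?thesis
    unfolding neg by (simp add: eqs saddle_field_def inner_prod_def inner_simps algebra_simps)
qed

lemma saddle_gap_le:
  assumes cvx: "convex_on X (\<lambda>x. \<phi> x v)" and ccv: "concave_on Y (\<lambda>y. \<phi> u y)"
    and g: "partial_gradients X Y \<phi> gx gy"
    and mem: "u \<in> X" "v \<in> Y" "x \<in> X" "y \<in> Y"
  shows "\<phi> u y - \<phi> x v \<le> saddle_field gx gy (u, v) \<bullet> ((u, v) - (x, y))"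
proof -
  have dx: "((\<lambda>x. \<phi> x v) has_derivative (\<lambda>h. gx u v \<bullet> h)) (at u within X)"
    and dy: "((\<lambda>y. \<phi> u y) has_derivative (\<lambda>h. gy u v \<bullet> h)) (at v within Y)"
    using g mem unfolding partial_gradients_def by blast+
  have "((\<lambda>y. - \<phi> u y) has_derivative (\<lambda>h. (- gy u v) \<bullet> h)) (at v within Y)"
    using has_derivative_minus[OF dy] by simp
  then have "(- gy u v) \<bullet> (y - v) \<le> - \<phi> u y - - \<phi> u v"
    using ccv mem unfolding concave_on_def by (intro convex_on_gradient_inequality)
  moreover have "gx u v \<bullet> (x - u) \<le> \<phi> x v - \<phi> u v"
    using cvx dx mem by (intro convex_on_gradient_inequality)
  ultimately show ?thesis by (simp add: saddle_field_def inner_prod_def inner_simps)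
qed

section \<open>Comparison points and extrema\<close>

text \<open>Moving a point of \<open>X\<close> slightly towards a point of \<open>X \<inter> D\<close> brings it into the interior of
  \<open>closure D\<close>, which is \<open>D\<close>.\<close>

lemma subset_closure_Int_convex_open:
  fixes X D :: "'a::euclidean_space set"
  assumes "convex X" "convex D" "open D" "X \<subseteq> closure D" "X \<inter> D \<noteq> {}"
  shows "X \<subseteq> closure (X \<inter> D)"
proof
  fix x assume x: "x \<in> X"
  obtain c where c: "c \<in> X" "c \<in> D" using assms(5) by auto
  define l where "l = (\<lambda>e::real. x - e *\<^sub>R (x - c))"
  have "l e \<in> X \<inter> D" if e: "0 < e" "e \<le> 1" for e
  proof
    have "(1 - e) *\<^sub>R x + e *\<^sub>R c \<in> X" using assms(1) x c e by (auto intro: convexD)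
    then show "l e \<in> X" by (simp add: l_def algebra_simps)
    have "l e \<in> interior D" unfolding l_def
      using assms x c e
      by (intro mem_interior_closure_convex_shrink) (auto simp: interior_open)
    then show "l e \<in> D" using interior_subset by blast
  qed
  then have "\<forall>\<^sub>F e in at_right 0. l e \<in> closure (X \<inter> D)"
    unfolding eventually_at_right_field using closure_subset
    by (intro exI[of _ 1]) force
  moreover have "(l \<longlongrightarrow> x - 0 *\<^sub>R (x - c)) (at_right 0)"
    unfolding l_def by (intro tendsto_intros)
  then have "(l \<longlongrightarrow> x) (at_right 0)" by simp
  ultimately show "x \<in> closure (X \<inter> D)"
    by (intro Lim_in_closed_set[where F = "at_right (0::real)"]) auto
qed

lemma min_on_eq:
  fixes f :: "'a \<Rightarrow> real"
  assumes "is_arg_min f (\<lambda>p. p \<in> S) x"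
  shows "min_on f S = f x"
proof -
  have "is_arg_min f (\<lambda>p. p \<in> S) (arg_min_on f S)"
    unfolding arg_min_on_def arg_min_def using assms by (rule someI)
  then show ?thesis
    using assms by (force simp: is_arg_min_def min_on_def)
qed

lemma min_on_attained:
  fixes f :: "'a::topological_space \<Rightarrow> real"
  assumes "compact S" "S \<noteq> {}" "continuous_on S f"
  obtains x where "x \<in> S" "min_on f S = f x"
proof -
  obtain x where "x \<in> S" "\<forall>y\<in>S. f x \<le> f y"
    using continuous_attains_inf[OF assms] by blast
  then have "is_arg_min f (\<lambda>p. p \<in> S) x" by (auto simp: is_arg_min_def not_less)
  then show ?thesis using min_on_eq \<open>x \<in> S\<close> that by metis
qed

lemma max_on_attained:
  fixes f :: "'a::topological_space \<Rightarrow> real"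
  assumes "compact S" "S \<noteq> {}" "continuous_on S f"
  obtains x where "x \<in> S" "max_on f S = f x"
proof -
  obtain x where "x \<in> S" "\<forall>y\<in>S. f y \<le> f x"
    using continuous_attains_sup[OF assms] by blast
  then have "is_arg_max f (\<lambda>p. p \<in> S) x" by (auto simp: is_arg_max_def not_less)
  then have "is_arg_max f (\<lambda>p. p \<in> S) (arg_max_on f S)"
    unfolding arg_max_on_def arg_max_def by (rule someI)
  then show ?thesis using that by (auto simp: is_arg_max_def max_on_def)
qed

lemma is_arg_min_joint_map:
  assumes "is_arg_min (joint_map a b f g) (\<lambda>p. p \<in> A \<times> B) z" "0 < a" "0 < b"
  shows "is_arg_min f (\<lambda>x. x \<in> A) (fst z)" "is_arg_min g (\<lambda>y. y \<in> B) (snd z)"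
proof -
  obtain x y where z: "z = (x, y)" "x \<in> A" "y \<in> B"
    using assms(1) by (auto simp: is_arg_min_def)
  have min: "a * f x + b * g y \<le> a * f x' + b * g y'" if "x' \<in> A" "y' \<in> B" for x' y'
    using assms(1) that z by (auto simp: is_arg_min_def joint_map_def not_less)
  have "f x \<le> f x'" if "x' \<in> A" for x' using min[OF that z(3)] assms by simp
  then show "is_arg_min f (\<lambda>x. x \<in> A) (fst z)" using z by (auto simp: is_arg_min_def not_less)
  have "g y \<le> g y'" if "y' \<in> B" for y' using min[OF z(2) that] assms by simp
  then show "is_arg_min g (\<lambda>y. y \<in> B) (snd z)" using z by (auto simp: is_arg_min_def not_less)
qed

lemma is_arg_min_oscillation_le:
  assumes "is_arg_min f (\<lambda>x. x \<in> S) x" "bdd_above (f ` S)" "y \<in> S"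
  shows "f y - f x \<le> (SUP x\<in>S. f x) - min_on f S"
  using cSUP_upper[OF assms(3,2)] min_on_eq[OF assms(1)] by simp

section \<open>Convergence of saddle point mirror prox\<close>

theorem theorem5p2:
  fixes NX :: "real^'n \<Rightarrow> real" and NY :: "real^'m \<Rightarrow> real"
    and X DX :: "(real^'n) set" and Y DY :: "(real^'m) set"
    and PhiX :: "real^'n \<Rightarrow> real" and PhiY :: "real^'m \<Rightarrow> real"
    and \<phi> :: "real^'n \<Rightarrow> real^'m \<Rightarrow> real"
    and gx :: "real^'n \<Rightarrow> real^'m \<Rightarrow> real^'n" and gy :: "real^'n \<Rightarrow> real^'m \<Rightarrow> real^'m"
    and \<beta>11 \<beta>12 \<beta>22 \<beta>21 RX RY M a b \<eta> :: real
    and z w :: "nat \<Rightarrow> (real^'n) \<times> (real^'m)"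
    and t :: nat
  assumes "is_norm NX" and "is_norm NY"
    and "compact X" and "convex X" and "compact Y" and "convex Y"
    and "mirror_map X DX PhiX" and "strongly_convex_wrt 1 NX (X \<inter> DX) PhiX"
    and "mirror_map Y DY PhiY" and "strongly_convex_wrt 1 NY (Y \<inter> DY) PhiY"
    and "bdd_above (PhiX ` (X \<inter> DX))" and "RX > 0"
    and "RX\<^sup>2 = (SUP x\<in>X \<inter> DX. PhiX x) - min_on PhiX (X \<inter> DX)"
    and "bdd_above (PhiY ` (Y \<inter> DY))" and "RY > 0"
    and "RY\<^sup>2 = (SUP y\<in>Y \<inter> DY. PhiY y) - min_on PhiY (Y \<inter> DY)"
    and "continuous_on (X \<times> Y) (\<lambda>(x, y). \<phi> x y)"
    and "\<And>y. y \<in> Y \<Longrightarrow> convex_on X (\<lambda>x. \<phi> x y)"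
    and "\<And>x. x \<in> X \<Longrightarrow> concave_on Y (\<lambda>y. \<phi> x y)"
    and "smooth_on \<beta>11 \<beta>12 \<beta>22 \<beta>21 NX NY X Y \<phi> gx gy"
    and "M = Max {\<beta>11 * RX\<^sup>2, \<beta>22 * RY\<^sup>2, \<beta>12 * RX * RY, \<beta>21 * RX * RY}" and "M > 0"
    and "a = 1 / RX\<^sup>2" and "b = 1 / RY\<^sup>2" and "\<eta> = 1 / (2 * M)"
    and "sp_mp ((X \<times> Y) \<inter> (DX \<times> DY)) (joint_map a b PhiX PhiY) \<eta> (saddle_field gx gy) z w"
    and "t \<ge> 1"
  shows "max_on (\<phi> ((1 / real t) *\<^sub>R (\<Sum>s=1..t. fst (w (s + 1))))) Y
       - min_on (\<lambda>x. \<phi> x ((1 / real t) *\<^sub>R (\<Sum>s=1..t. snd (w (s + 1))))) X \<le> 4 * M / real t"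
proof -
  note N = assms(1,2) and mX = assms(7) and mY = assms(9)
    and scX = assms(8) and scY = assms(10)
    and cont = assms(17) and cvx = assms(18) and ccv = assms(19) and sm = assms(20)
    and a = assms(23) and b = assms(24) and \<eta> = assms(25)
  have R: "0 < RX" "0 < RY" and M: "0 < M" and t: "1 \<le> t" using assms by auto
  define S where "S = (X \<inter> DX) \<times> (Y \<inter> DY)"
  define Phi where "Phi = joint_map a b PhiX PhiY"
  define F where "F = saddle_field gx gy"
  have mp: "sp_mp S Phi \<eta> F z w"
    using assms(26) by (simp add: S_def Phi_def F_def Times_Int_Times)
  have ab: "0 < a" "0 < b" using R by (simp_all add: a b)

  have derX: "GDERIV PhiX x :> grad PhiX x" if "x \<in> DX" for x
    using mX that by (auto simp: mirror_map_def intro: GDERIV_grad)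
  have derY: "GDERIV PhiY y :> grad PhiY y" if "y \<in> DY" for y
    using mY that by (auto simp: mirror_map_def intro: GDERIV_grad)
  have der: "GDERIV Phi q :> grad Phi q" if "q \<in> S" for q
  proof -
    have "GDERIV Phi q :> (a *\<^sub>R grad PhiX (fst q), b *\<^sub>R grad PhiY (snd q))"
      unfolding Phi_def using that by (intro GDERIV_joint_map derX derY) (auto simp: S_def)
    then show ?thesis using grad_eq by metis
  qed
  have S: "convex S"
    using assms(4,6) mX mY by (auto simp: S_def mirror_map_def intro!: convex_Times convex_Int)
  have breg: "a * ((NX (fst (p - q)))\<^sup>2 / 2) + b * ((NY (snd (p - q)))\<^sup>2 / 2) \<le> bregman Phi p q"
    if "p \<in> S" "q \<in> S" for p q
  proof -
    have "(NX (fst p - fst q))\<^sup>2 / 2 \<le> bregman PhiX (fst p) (fst q)"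
      using that by (intro strongly_convex_wrt_bregman_ge[OF scX] N) (auto simp: S_def)
    moreover have "(NY (snd p - snd q))\<^sup>2 / 2 \<le> bregman PhiY (snd p) (snd q)"
      using that by (intro strongly_convex_wrt_bregman_ge[OF scY] N) (auto simp: S_def)
    moreover have "bregman Phi p q
        = a * bregman PhiX (fst p) (fst q) + b * bregman PhiY (snd p) (snd q)"
      unfolding Phi_def using that by (intro bregman_joint_map derX derY) (auto simp: S_def)
    ultimately show ?thesis using ab by (simp add: add_mono mult_left_mono)
  qed
  have breg_nonneg: "0 \<le> bregman Phi p q" if "p \<in> S" "q \<in> S" for p q
    by (rule order_trans[OF _ breg[OF that]]) (use ab in simp)
  have absorb: "\<eta> * ((F q - F p) \<bullet> (q - r)) \<le> bregman Phi q p + bregman Phi r q"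
    if mem: "p \<in> S" "q \<in> S" "r \<in> S" for p q r
  proof -
    have nn: "0 \<le> NX e" "0 \<le> NY e'" for e e'
      using N by (auto simp: is_norm_def)
    have sym: "NX (fst (q - r)) = NX (fst (r - q))" "NY (snd (q - r)) = NY (snd (r - q))"
      using N by (simp_all add: is_norm_minus_commute)
    have "M \<ge> \<beta>11 * RX\<^sup>2" "M \<ge> \<beta>22 * RY\<^sup>2" "M \<ge> \<beta>12 * RX * RY" "M \<ge> \<beta>21 * RX * RY"
      unfolding assms(21) by (auto intro: Max_ge)
    note w = weighted_cross_terms_le[OF nn(1,2,1,2) R M this]
    have "(F q - F p) \<bullet> (q - r)
      \<le> (\<beta>11 * NX (fst (q - p)) + \<beta>12 * NY (snd (q - p))) * NX (fst (q - r))
        + (\<beta>21 * NX (fst (q - p)) + \<beta>22 * NY (snd (q - p))) * NY (snd (q - r))"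
      unfolding F_def using mem by (intro saddle_field_increment_le[OF N sm]) (auto simp: S_def)
    then have "\<eta> * ((F q - F p) \<bullet> (q - r)) \<le> \<eta> *
      ((\<beta>11 * NX (fst (q - p)) + \<beta>12 * NY (snd (q - p))) * NX (fst (q - r))
        + (\<beta>21 * NX (fst (q - p)) + \<beta>22 * NY (snd (q - p))) * NY (snd (q - r)))"
      using M by (intro mult_left_mono) (auto simp: \<eta>)
    also have "\<dots> \<le> a * ((NX (fst (q - p)))\<^sup>2 / 2) + b * ((NY (snd (q - p)))\<^sup>2 / 2)
        + (a * ((NX (fst (q - r)))\<^sup>2 / 2) + b * ((NY (snd (q - r)))\<^sup>2 / 2))"
      unfolding a b \<eta> by (rule w)
    also have "\<dots> \<le> bregman Phi q p + bregman Phi r q"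
      unfolding sym using mem by (intro add_mono breg)
    finally show ?thesis .
  qed

  \<comment> \<open>The weights normalise the oscillation of each mirror map to 1.\<close>
  have osc: "Phi p - Phi (z 1) \<le> 2" if "p \<in> S" for p
  proof -
    have z1: "is_arg_min (joint_map a b PhiX PhiY) (\<lambda>p. p \<in> (X \<inter> DX) \<times> (Y \<inter> DY)) (z 1)"
      using mp by (auto simp: sp_mp_def S_def Phi_def)
    note min = is_arg_min_joint_map[OF z1 ab]
    have "PhiX (fst p) - PhiX (fst (z 1)) \<le> RX\<^sup>2" unfolding assms(13)
      using that by (intro is_arg_min_oscillation_le min assms) (auto simp: S_def)
    moreover have "PhiY (snd p) - PhiY (snd (z 1)) \<le> RY\<^sup>2" unfolding assms(16)
      using that by (intro is_arg_min_oscillation_le min assms) (auto simp: S_def)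
    ultimately have "a * (PhiX (fst p) - PhiX (fst (z 1))) + b * (PhiY (snd p) - PhiY (snd (z 1)))
        \<le> a * RX\<^sup>2 + b * RY\<^sup>2"
      using ab by (intro add_mono mult_left_mono) auto
    also have "\<dots> = 2" using R by (simp add: a b)
    finally show ?thesis by (simp add: Phi_def joint_map_def algebra_simps)
  qed

  define regret where "regret = (\<lambda>p. \<Sum>s=1..t. \<eta> * (F (w (s + 1)) \<bullet> (w (s + 1) - p)))"
  have regret: "regret p \<le> 2" if "p \<in> X \<times> Y" for p
  proof -
    have "S \<subseteq> {p. regret p \<le> 2}"
      using order_trans[OF mirror_prox_regret[OF mp S der breg_nonneg absorb] osc]
      by (auto simp: regret_def)
    moreover have "closed {p. regret p \<le> 2}"
      unfolding regret_def by (intro closed_Collect_le continuous_intros)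
    ultimately have "closure S \<subseteq> {p. regret p \<le> 2}" by (rule closure_minimal)
    moreover have "X \<times> Y \<subseteq> closure S"
      using subset_closure_Int_convex_open[of X DX] subset_closure_Int_convex_open[of Y DY]
        mX mY assms(4,6) by (auto simp: S_def closure_Times mirror_map_def)
    ultimately show ?thesis using that by blast
  qed

  define u v where "u = (\<lambda>s. fst (w (s + 1)))" and "v = (\<lambda>s. snd (w (s + 1)))"
  have "w (s + 1) \<in> S" if "s \<ge> 1" for s
    using mp that by (auto simp: sp_mp_def is_arg_min_def)
  then have uv: "u s \<in> X" "v s \<in> Y" if "s \<ge> 1" for s
    using that by (auto simp: S_def u_def v_def mem_Times_iff)
  define ub vb where "ub = (\<Sum>s=1..t. (1 / real t) *\<^sub>R u s)"
    and "vb = (\<Sum>s=1..t. (1 / real t) *\<^sub>R v s)"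
  have weights: "(\<Sum>s=1..t. 1 / real t) = 1" and ne: "{1..t} \<noteq> {}" using t by auto
  have ub: "ub \<in> X" and vb: "vb \<in> Y"
    unfolding ub_def vb_def using assms(4,6) uv weights by (auto intro!: convex_sum)
  have gap: "\<phi> ub y - \<phi> x vb \<le> 4 * M / real t" if xy: "x \<in> X" "y \<in> Y" for x y
  proof -
    have "\<phi> ub y \<le> (\<Sum>s=1..t. 1 / real t * \<phi> (u s) y)"
      unfolding ub_def using uv weights ne
      by (intro convex_on_sum[OF _ _ cvx[OF xy(2)]]) auto
    moreover have "- \<phi> x vb \<le> (\<Sum>s=1..t. 1 / real t * - \<phi> x (v s))"
      unfolding vb_def using uv weights ne
      by (intro convex_on_sum[OF _ _ ccv[OF xy(1), unfolded concave_on_def]]) auto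
    ultimately have "\<phi> ub y - \<phi> x vb
        \<le> (\<Sum>s=1..t. 1 / real t * \<phi> (u s) y) + (\<Sum>s=1..t. 1 / real t * - \<phi> x (v s))"
      by linarith
    also have "\<dots> = (\<Sum>s=1..t. \<phi> (u s) y - \<phi> x (v s)) / real t"
      by (simp add: sum_divide_distrib sum.distrib[symmetric] diff_divide_distrib)
    also have "\<dots> \<le> (\<Sum>s=1..t. F (w (s + 1)) \<bullet> (w (s + 1) - (x, y))) / real t"
    proof (intro divide_right_mono sum_mono)
      fix s assume "s \<in> {1..t}"
      then show "\<phi> (u s) y - \<phi> x (v s) \<le> F (w (s + 1)) \<bullet> (w (s + 1) - (x, y))"
        using saddle_gap_le[OF cvx[of "v s"] ccv[of "u s"], of gx gy x y] sm uv[of s] xy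
        by (simp add: smooth_on_def F_def u_def v_def)
    qed simp
    also have "\<dots> = 2 * M * regret (x, y) / real t"
      using M by (simp add: regret_def \<eta> sum_distrib_left)
    also have "\<dots> \<le> 2 * M * 2 / real t"
      using M regret[of "(x, y)"] xy by (intro divide_right_mono mult_left_mono) auto
    finally show ?thesis by simp
  qed

  have "continuous_on Y (\<phi> ub)"
    using continuous_on_compose2[OF cont continuous_on_Pair[OF continuous_on_const
        continuous_on_id], of ub Y] ub by auto
  then obtain y where y: "y \<in> Y" "max_on (\<phi> ub) Y = \<phi> ub y"
    using max_on_attained[OF assms(5)] vb by blast
  have "continuous_on X (\<lambda>x. \<phi> x vb)"
    using continuous_on_compose2[OF cont continuous_on_Pair[OF continuous_on_id
        continuous_on_const], of vb X] vb by auto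
  then obtain x where x: "x \<in> X" "min_on (\<lambda>x. \<phi> x vb) X = \<phi> x vb"
    using min_on_attained[OF assms(3)] ub by blast
  show ?thesis
    using gap[OF x(1) y(1)] x(2) y(2)
    by (simp add: ub_def vb_def u_def v_def scaleR_sum_right)
qed

end
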